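(* The mapping $n\mapsto t_n$ is a bijection from $\mathbb{N}=\{0,1,2,\dots\}$ to the set $\mathbb{Q}_+$ of non-negative rational numbers.
   Context: Define triples of integers $N_n=(a_n;b_n;c_n)$ for every integer $n\geqslant 1$ as the labels of the vertices of a ternary tree $\mathcal{A}_3$ read from the top and, at each level, from left to right. The top is $N_1=(1;2;0)$. For every $n\geqslant 1$, the left, middle and right children of $N_n=(a;b;c)$ are respectively $N_{3n-1}$, $N_{3n}$, $N_{3n+1}$, and they are given by: - if $b$ is odd: $N_{3n-1}=(4(c+1)a-b;\,2a;\,0)$, $N_{3n}=(a;\,2a+b;\,c+1)$, $N_{3n+1}=(2a+b;\,2a+2b;\,0)$; - if $b$ is even: $N_{3n-1}=(2(c+1)a-\frac{b}{2};\,a;\,0)$, $N_{3n}=(a;\,2a+b;\,c+1)$, $N_{3n+1}=(a+\frac{b}{2};\,a+b;\,0)$. The sequence $(t_n)_{n\in\mathbb{N}}$ is defined by $t_0=0$ and $t_n=\frac{a_n}{b_n}$ for every $n\geqslant 1$. *)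

theory Defs
  imports Complex_Main
begin

text \<open>
  A label \<open>(a, b, c)\<close> is a triple of integers. In the branches where \<open>b\<close> is even,
  \<open>b div 2\<close> is the exact quotient.
\<close>

fun left_child :: "int \<times> int \<times> int \<Rightarrow> int \<times> int \<times> int" where
  "left_child (a, b, c) =
     (if odd b then (4 * (c + 1) * a - b, 2 * a, 0)
      else (2 * (c + 1) * a - b div 2, a, 0))"

fun middle_child :: "int \<times> int \<times> int \<Rightarrow> int \<times> int \<times> int" where
  "middle_child (a, b, c) = (a, 2 * a + b, c + 1)"

fun right_child :: "int \<times> int \<times> int \<Rightarrow> int \<times> int \<times> int" where
  "right_child (a, b, c) =
     (if odd b then (2 * a + b, 2 * a + 2 * b, 0)
      else (a + b div 2, a + b, 0))"

text \<open>
  The vertex numbered \<open>n \<ge> 2\<close> has parent \<open>(n + 1) div 3\<close>, and the residue of \<open>n\<close>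
  modulo 3 tells which child it is; see \<open>label_left\<close>, \<open>label_middle\<close>, \<open>label_right\<close>
  below for the description by children. The tree has no vertex numbered 0, so
  \<open>label 0\<close> is left unspecified.
\<close>

function label :: "nat \<Rightarrow> int \<times> int \<times> int" where
  "label n =
     (if n = 0 then undefined
      else if n = 1 then (1, 2, 0)
      else if n mod 3 = 2 then left_child (label ((n + 1) div 3))
      else if n mod 3 = 0 then middle_child (label ((n + 1) div 3))
      else right_child (label ((n + 1) div 3)))"
  by auto
termination
  by (relation "measure id") auto

declare label.simps [simp del]

lemma label_1: "label 1 = (1, 2, 0)"
  by (subst label.simps) simp

lemma label_left:
  assumes "n \<ge> 1"
  shows "label (3 * n - 1) = left_child (label n)"
proof -
  obtain m where m: "n = Suc m"
    using assms by (cases n) auto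
  have idx: "3 * n - 1 = 3 * m + 2" "n = (3 * m + 2 + 1) div 3"
    by (simp_all add: m)
  have "3 * m + 2 \<noteq> 0" "3 * m + 2 \<noteq> 1" "(3 * m + 2) mod 3 = 2"
    by presburger+
  then show ?thesis
    unfolding idx(1) by (simp only: label.simps [of "3 * m + 2"] idx(2) [symmetric] if_False if_True refl)
qed

lemma label_middle:
  assumes "n \<ge> 1"
  shows "label (3 * n) = middle_child (label n)"
proof -
  have "3 * n \<noteq> 0" "3 * n \<noteq> 1" "3 * n mod 3 \<noteq> 2" "3 * n mod 3 = 0" "(3 * n + 1) div 3 = n"
    using assms by (simp_all, (presburger+)?)
  then show ?thesis
    by (simp only: label.simps [of "3 * n"] if_False if_True refl)
qed

lemma label_right:
  assumes "n \<ge> 1"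
  shows "label (3 * n + 1) = right_child (label n)"
proof -
  have "3 * n + 1 \<noteq> 0" "3 * n + 1 \<noteq> 1" "(3 * n + 1) mod 3 \<noteq> 2"
    "(3 * n + 1) mod 3 \<noteq> 0" "(3 * n + 1 + 1) div 3 = n"
    using assms by (simp_all, (presburger+)?)
  then show ?thesis
    by (simp only: label.simps [of "3 * n + 1"] if_False if_True refl)
qed

definition t :: "nat \<Rightarrow> rat" where
  "t n = (if n = 0 then 0 else (case label n of (a, b, c) \<Rightarrow> of_int a / of_int b))"

end

theory Submission
  imports Defs
begin

text \<open>
  The three rules for the children become parity-free in the coordinate \<open>u = 1 / (2 t)\<close>, that is
  \<open>u = b / (2 a)\<close>: the even and the odd rule differ only by a common factor 2 in \<open>a\<close> and \<open>b\<close>.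
  The third component is redundant as well. It counts how often 1 has been added to \<open>u\<close> since the
  last left or right move, and \<open>u\<close> lies in \<open>(0, 1]\<close> just after such a move and at the root, so
  \<open>c + 1 = \<lceil>u\<rceil>\<close> (\<open>label_invariant\<close>). The tree is therefore generated from \<open>u = 1\<close> by the maps
  \<^item> left: \<open>x \<mapsto> 1 / (2 (2 \<lceil>x\<rceil> - x))\<close>, with values in \<open>(0, 1/2]\<close>,
  \<^item> right: \<open>x \<mapsto> (1 + 2 x) / (2 + 2 x)\<close>, with values in \<open>(1/2, 1)\<close>,
  \<^item> middle: \<open>x \<mapsto> x + 1\<close>, with values in \<open>(1, \<infinity>)\<close>.

  These ranges and the root value 1 partition the positive rationals, and each of the maps is
  injective; hence a value determines the whole path from the root, and distinct vertices carry
  distinct values (\<open>vertex_value_inj\<close>). For surjectivity one descends: going back along the left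
  or the right map lowers the denominator, and going back along the middle map keeps the
  denominator and lowers the numerator (\<open>vertex_value_surj\<close>). Since \<open>q \<mapsto> 1 / (2 q)\<close> permutes the
  positive rationals, \<open>t\<close> is a bijection from the positive integers to the positive rationals,
  and \<open>t 0 = 0\<close> supplies the remaining value.
\<close>

definition left_map :: "rat \<Rightarrow> rat" where
  "left_map x = 1 / (2 * (2 * of_int \<lceil>x\<rceil> - x))"

definition right_map :: "rat \<Rightarrow> rat" where
  "right_map x = (1 + 2 * x) / (2 + 2 * x)"

definition vertex_value :: "nat \<Rightarrow> rat" where
  "vertex_value n = (case label n of (a, b, c) \<Rightarrow> of_int b / (2 * of_int a))"

lemma vertex_cases [consumes 1, case_names root left middle right]:
  fixes n :: nat
  assumes "n \<ge> 1"
  obtains "n = 1"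
    | m where "m \<ge> 1" "m < n" "n = 3 * m - 1"
    | m where "m \<ge> 1" "m < n" "n = 3 * m"
    | m where "m \<ge> 1" "m < n" "n = 3 * m + 1"
proof -
  let ?m = "(n + 1) div 3"
  have "n = 1 \<or> ?m \<ge> 1 \<and> ?m < n \<and> (n = 3 * ?m - 1 \<or> n = 3 * ?m \<or> n = 3 * ?m + 1)"
    using assms by presburger
  then show thesis using that by blast
qed

lemma vertex_induct [consumes 1, case_names root left middle right]:
  fixes n :: nat
  assumes "n \<ge> 1"
    and "P 1"
    and "\<And>m. m \<ge> 1 \<Longrightarrow> P m \<Longrightarrow> P (3 * m - 1)"
    and "\<And>m. m \<ge> 1 \<Longrightarrow> P m \<Longrightarrow> P (3 * m)"
    and "\<And>m. m \<ge> 1 \<Longrightarrow> P m \<Longrightarrow> P (3 * m + 1)"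
  shows "P n"
  using assms(1)
proof (induction n rule: less_induct)
  case (less n)
  from \<open>n \<ge> 1\<close> show ?case
    by (cases rule: vertex_cases) (use less.IH assms(2-) in auto)
qed

section \<open>The tree in the coordinate \<open>u\<close>\<close>

text \<open>
  The inequalities say \<open>c < b / (2 a) \<le> c + 1\<close>, which is what identifies \<open>c + 1\<close> with
  \<open>\<lceil>b / (2 a)\<rceil>\<close>.
\<close>
lemma label_invariant:
  assumes "n \<ge> 1"
  shows "case label n of (a, b, c) \<Rightarrow> 0 < a \<and> 0 \<le> c \<and> 2 * c * a < b \<and> b \<le> 2 * (c + 1) * a"
  using assms
proof (induction n rule: vertex_induct)
  case root
  show ?case using label_1 by simp
next
  case (left m)
  obtain a b c where l: "label m = (a, b, c)" by (cases "label m") auto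
  have ab: "0 < a" "0 \<le> c" "2 * c * a < b" "b \<le> 2 * (c + 1) * a" using left l by auto
  have "0 \<le> c * a" using ab by simp
  then have "0 < b" using ab by linarith
  have "a \<le> 4 * (c + 1) * a - b"
    using ab(1,4) \<open>0 \<le> c * a\<close> by (simp add: algebra_simps)
  then show ?case
    unfolding label_left[OF left(1)] l using ab(1) by (auto simp: algebra_simps elim!: evenE)
next
  case (middle m)
  obtain a b c where l: "label m = (a, b, c)" by (cases "label m") auto
  show ?case
    unfolding label_middle[OF middle(1)] l using middle l by (auto simp: algebra_simps)
next
  case (right m)
  obtain a b c where l: "label m = (a, b, c)" by (cases "label m") auto
  have ab: "0 < a" "0 \<le> c" "2 * c * a < b" "b \<le> 2 * (c + 1) * a" using right l by auto
  have "0 \<le> c * a" using ab by simp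
  then have "0 < b" using ab by linarith
  show ?case
    unfolding label_right[OF right(1)] l using ab \<open>0 < b\<close>
    by (auto simp: algebra_simps elim!: evenE)
qed

lemma label_props:
  assumes "n \<ge> 1"
  obtains a b c where "label n = (a, b, c)" "0 < a" "0 < b"
    "vertex_value n = of_int b / (2 * of_int a)" "\<lceil>vertex_value n\<rceil> = c + 1"
proof -
  obtain a b c where l: "label n = (a, b, c)" by (cases "label n") auto
  have ab: "0 < a" "0 \<le> c" "2 * c * a < b" "b \<le> 2 * (c + 1) * a"
    using label_invariant[OF assms] l by auto
  have "0 \<le> c * a" using ab by simp
  then have "0 < b" using ab by linarith
  have u: "vertex_value n = of_int b / (2 * of_int a)" by (simp add: vertex_value_def l)
  have "of_int (2 * c * a) < (of_int b :: rat)" "(of_int b :: rat) \<le> of_int (2 * (c + 1) * a)"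
    using ab(3,4) by (simp_all only: of_int_less_iff of_int_le_iff)
  then have "\<lceil>vertex_value n\<rceil> = c + 1"
    unfolding u using ab(1) by (intro ceiling_unique) (simp_all add: field_simps)
  with l ab(1) \<open>0 < b\<close> u show thesis by (rule that)
qed

lemma vertex_value_pos:
  assumes "n \<ge> 1"
  shows "0 < vertex_value n"
  using label_props[OF assms] by (metis divide_pos_pos mult_pos_pos of_int_0_less_iff zero_less_numeral)

lemma vertex_value_root: "vertex_value 1 = 1"
  using label_1 by (simp add: vertex_value_def)

lemma vertex_value_left:
  assumes "n \<ge> 1"
  shows "vertex_value (3 * n - 1) = left_map (vertex_value n)"
proof -
  obtain a b c where l: "label n = (a, b, c)" "0 < a" "0 < b"
    "vertex_value n = of_int b / (2 * of_int a)" "\<lceil>vertex_value n\<rceil> = c + 1"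
    using label_props[OF assms] .
  have "vertex_value (3 * n - 1) = of_int a / of_int (4 * (c + 1) * a - b)"
  proof (cases "odd b")
    case True
    then have "vertex_value (3 * n - 1) = of_int (2 * a) / (2 * of_int (4 * (c + 1) * a - b))"
      unfolding vertex_value_def label_left[OF assms] l(1) by simp
    also have "\<dots> = of_int a / of_int (4 * (c + 1) * a - b)"
      unfolding of_int_mult[of 2 a] of_int_numeral by (rule mult_divide_mult_cancel_left) simp
    finally show ?thesis .
  next
    case False
    then obtain d where d: "b = 2 * d" using evenE by blast
    have "of_int (4 * (c + 1) * a - b) = 2 * (of_int (2 * (c + 1) * a - d) :: rat)"
      by (simp add: d algebra_simps)
    then show ?thesis
      by (simp add: vertex_value_def label_left[OF assms, simplified] l(1) d)
  qed
  also have "of_int (4 * (c + 1) * a - b)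
      = (of_int a :: rat) * (2 * (2 * of_int (c + 1) - of_int b / (2 * of_int a)))"
    using l(2) by (simp add: field_simps)
  also have "of_int a / \<dots> = left_map (of_int b / (2 * of_int a))"
    unfolding left_map_def l(5)[unfolded l(4)] using l(2) by simp
  finally show ?thesis by (simp add: l(4))
qed

lemma vertex_value_middle:
  assumes "n \<ge> 1"
  shows "vertex_value (3 * n) = vertex_value n + 1"
proof -
  obtain a b c where l: "label n = (a, b, c)" "0 < a"
    using label_props[OF assms] by metis
  show ?thesis
    unfolding vertex_value_def label_middle[OF assms] l(1) using l(2) by (simp add: field_simps)
qed

lemma vertex_value_right:
  assumes "n \<ge> 1"
  shows "vertex_value (3 * n + 1) = right_map (vertex_value n)"
proof -
  obtain a b c where l: "label n = (a, b, c)" "0 < a"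
    "vertex_value n = of_int b / (2 * of_int a)"
    using label_props[OF assms] by metis
  have "vertex_value (3 * n + 1) = of_int (a + b) / of_int (2 * a + b)"
  proof (cases "odd b")
    case True
    then have "vertex_value (3 * n + 1) = of_int (2 * (a + b)) / (2 * of_int (2 * a + b))"
      unfolding vertex_value_def label_right[OF assms] l(1) by simp
    also have "\<dots> = of_int (a + b) / of_int (2 * a + b)"
      unfolding of_int_mult[of 2 "a + b"] of_int_numeral
      by (rule mult_divide_mult_cancel_left) simp
    finally show ?thesis .
  next
    case False
    then obtain d where d: "b = 2 * d" using evenE by blast
    have "of_int (2 * a + b) = 2 * (of_int (a + d) :: rat)" by (simp add: d)
    then show ?thesis
      by (simp add: vertex_value_def label_right[OF assms, simplified] l(1) d)
  qed
  also have "of_int (a + b) = (of_int a :: rat) * (1 + 2 * (of_int b / (2 * of_int a)))"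
    using l(2) by (simp add: field_simps)
  also have "of_int (2 * a + b) = (of_int a :: rat) * (2 + 2 * (of_int b / (2 * of_int a)))"
    using l(2) by (simp add: field_simps)
  also have "of_int a * (1 + 2 * (of_int b / (2 * of_int a)))
      / (of_int a * (2 + 2 * (of_int b / (2 * of_int a)))) = right_map (of_int b / (2 * of_int a))"
    unfolding right_map_def using l(2) by (intro mult_divide_mult_cancel_left) simp
  finally show ?thesis by (simp add: l(3))
qed

lemma t_eq_vertex_value:
  assumes "n \<ge> 1"
  shows "t n = 1 / (2 * vertex_value n)"
proof -
  obtain a b c where "label n = (a, b, c)" "0 < a" "0 < b"
    using label_props[OF assms] by metis
  then show ?thesis using assms by (simp add: t_def vertex_value_def)
qed

section \<open>Injectivity\<close>

lemma left_map_range: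
  assumes "0 < x"
  shows "0 < left_map x" "left_map x \<le> 1 / 2"
proof -
  have "1 \<le> \<lceil>x\<rceil>" using assms by (simp add: one_le_ceiling)
  then have "(1 :: rat) \<le> of_int \<lceil>x\<rceil>" by simp
  then have "1 \<le> 2 * of_int \<lceil>x\<rceil> - x" using le_of_int_ceiling[of x] by linarith
  then show "0 < left_map x" "left_map x \<le> 1 / 2"
    unfolding left_map_def by (simp_all add: field_simps)
qed

lemma right_map_range:
  assumes "0 < x"
  shows "1 / 2 < right_map x" "right_map x < 1"
  using assms by (simp_all add: right_map_def field_simps)

text \<open>
  The value \<open>1 / (2 y)\<close> at \<open>x\<close> gives \<open>y = 2 \<lceil>x\<rceil> - x\<close>, and \<open>y\<close> determines \<open>x\<close> because
  \<open>\<lceil>x\<rceil> = \<lfloor>y\<rfloor>\<close>.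
\<close>
lemma left_map_inj: "inj left_map"
proof (rule injI)
  fix x y :: rat
  have floor: "\<lfloor>2 * of_int \<lceil>z\<rceil> - z\<rfloor> = \<lceil>z\<rceil>" for z :: rat
    by (rule floor_unique) (use le_of_int_ceiling[of z] ceiling_correct[of z] in linarith)+
  assume "left_map x = left_map y"
  then have eq: "2 * of_int \<lceil>x\<rceil> - x = 2 * of_int \<lceil>y\<rceil> - y"
    by (simp add: left_map_def)
  then have "\<lceil>x\<rceil> = \<lceil>y\<rceil>" using floor by metis
  with eq show "x = y" by simp
qed

lemma right_map_inj_on_pos: "inj_on right_map {0<..}"
  by (rule inj_onI) (auto simp: right_map_def field_simps)

text \<open>
  The ranges of the three maps are disjoint and avoid 1, so equal values force the same kind of
  vertex, and injectivity of the map in question passes the equality on to the parents.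
\<close>
lemma vertex_value_inj:
  assumes "m \<ge> 1" "n \<ge> 1" "vertex_value m = vertex_value n"
  shows "m = n"
  using assms
proof (induction m arbitrary: n rule: vertex_induct)
  case root
  from \<open>n \<ge> 1\<close> show ?case
  proof (cases rule: vertex_cases)
    case root then show ?thesis by simp
  next
    case (left k)
    then show ?thesis
      using root left_map_range[OF vertex_value_pos] vertex_value_left vertex_value_root
      by fastforce
  next
    case (middle k)
    then show ?thesis
      using root vertex_value_pos[of k] vertex_value_middle[of k] vertex_value_root by simp
  next
    case (right k)
    then show ?thesis
      using root right_map_range[OF vertex_value_pos[of k]] vertex_value_right[of k]
        vertex_value_root by simp
  qed
next
  case (left m)
  have v: "vertex_value n = left_map (vertex_value m)" "vertex_value n \<le> 1 / 2"
    using left vertex_value_left left_map_range(2)[OF vertex_value_pos] by metis+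
  from \<open>n \<ge> 1\<close> show ?case
  proof (cases rule: vertex_cases)
    case root
    then show ?thesis using v vertex_value_root by simp
  next
    case (left k)
    then have "vertex_value m = vertex_value k"
      using v(1) vertex_value_left[of k] left_map_inj by (auto dest: injD)
    then show ?thesis using left left.IH by simp
  next
    case (middle k)
    then show ?thesis using v(2) vertex_value_pos[of k] vertex_value_middle[of k] by simp
  next
    case (right k)
    then show ?thesis
      using v(2) right_map_range[OF vertex_value_pos[of k]] vertex_value_right[of k] by simp
  qed
next
  case (middle m)
  have v: "vertex_value n = vertex_value m + 1" "vertex_value n > 1"
    using middle vertex_value_middle[of m] vertex_value_pos[of m] by simp_all
  from \<open>n \<ge> 1\<close> show ?case
  proof (cases rule: vertex_cases)
    case root
    then show ?thesis using v vertex_value_root by simp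
  next
    case (left k)
    then show ?thesis
      using v(2) left_map_range[OF vertex_value_pos[of k]] vertex_value_left[of k] by simp
  next
    case (middle k)
    then have "vertex_value m = vertex_value k"
      using v(1) vertex_value_middle[of k] by simp
    then show ?thesis using middle middle.IH by simp
  next
    case (right k)
    then show ?thesis
      using v(2) right_map_range[OF vertex_value_pos[of k]] vertex_value_right[of k] by simp
  qed
next
  case (right m)
  have "0 < vertex_value m" using \<open>m \<ge> 1\<close> by (rule vertex_value_pos)
  have v: "vertex_value n = right_map (vertex_value m)" "1 / 2 < vertex_value n" "vertex_value n < 1"
    using right vertex_value_right right_map_range[OF vertex_value_pos] by metis+
  from \<open>n \<ge> 1\<close> show ?case
  proof (cases rule: vertex_cases)
    case root
    then show ?thesis using v vertex_value_root by simp
  next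
    case (left k)
    then show ?thesis
      using v(2) left_map_range[OF vertex_value_pos[of k]] vertex_value_left[of k] by simp
  next
    case (middle k)
    then show ?thesis using v(3) vertex_value_pos[of k] vertex_value_middle[of k] by simp
  next
    case (right k)
    then have "vertex_value m = vertex_value k"
      using v(1) vertex_value_right[of k] vertex_value_pos[of k] \<open>0 < vertex_value m\<close>
      by (intro inj_onD[OF right_map_inj_on_pos, of "vertex_value m" "vertex_value k"]) simp_all
    then show ?thesis using right right.IH by simp
  qed
qed

section \<open>Surjectivity\<close>

lemma left_map_floor:
  assumes "0 < x"
  shows "left_map (2 * of_int \<lfloor>1 / (2 * x)\<rfloor> - 1 / (2 * x)) = x"
proof -
  let ?y = "1 / (2 * x)"
  have "\<lceil>2 * of_int \<lfloor>?y\<rfloor> - ?y\<rceil> = \<lfloor>?y\<rfloor>"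
    by (rule ceiling_unique) (use floor_correct[of ?y] in linarith)+
  then show ?thesis using assms by (simp add: left_map_def)
qed

lemma right_map_inverse:
  assumes "x < 1"
  shows "right_map ((2 * x - 1) / (2 * (1 - x))) = x"
  using assms by (simp add: right_map_def divide_simps)

text \<open>
  The descent works with arbitrary fractions \<open>p / q\<close>, not only reduced ones, so no greatest
  common divisors enter. It is lexicographic in \<open>(q, p)\<close>: the preimage of \<open>p / q\<close> has denominator
  \<open>2 p\<close> under the left map, \<open>2 (q - p)\<close> under the right map and \<open>q\<close> under the middle map. The
  value \<open>1 / 2\<close> is treated apart because there \<open>2 p = q\<close> is no smaller; its preimage under the
  left map is the root value.
\<close>
lemma vertex_value_surj_fraction:
  fixes p q :: nat
  assumes "0 < p" "0 < q"
  shows "\<exists>n\<ge>1. vertex_value n = of_nat p / of_nat q"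
  using assms
proof (induction q arbitrary: p rule: less_induct)
  case denominator: (less q)
  from denominator.prems(1) show ?case
  proof (induction p rule: less_induct)
    case numerator: (less p)
    let ?x = "of_nat p / of_nat q :: rat"
    have pos: "0 < ?x" using numerator.prems denominator.prems by simp
    consider "p = q" | "q < p" | "2 * p = q" | "q < 2 * p" "p < q" | "2 * p < q" by linarith
    then show ?case
    proof cases
      case 1
      then show ?thesis using denominator.prems vertex_value_root by auto
    next
      case 2
      then obtain n where n: "n \<ge> 1" "vertex_value n = of_nat (p - q) / of_nat q"
        using numerator.IH[of "p - q"] denominator.prems by auto
      then have "vertex_value (3 * n) = ?x"
        using 2 denominator.prems by (simp add: vertex_value_middle of_nat_diff diff_divide_distrib)
      then show ?thesis using n(1) by (intro exI[of _ "3 * n"]) simp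
    next
      case 3
      have "vertex_value (3 * 1 - 1) = 1 / 2"
        by (subst vertex_value_left) (simp_all only: vertex_value_root, simp_all add: left_map_def)
      also have "\<dots> = ?x" using 3 numerator.prems by (auto simp: field_simps)
      finally show ?thesis by (intro exI[of _ "3 * 1 - 1"]) simp
    next
      case 4
      then have "2 * (q - p) < q" "0 < 2 * p - q" "0 < 2 * (q - p)" by linarith+
      then obtain n where n: "n \<ge> 1" "vertex_value n = of_nat (2 * p - q) / of_nat (2 * (q - p))"
        using denominator.IH by blast
      have "of_nat (2 * p - q) / of_nat (2 * (q - p)) = (2 * ?x - 1) / (2 * (1 - ?x))"
        using 4 denominator.prems by (simp add: of_nat_diff divide_simps)
      moreover have "?x < 1" using 4 by simp
      ultimately have "vertex_value (3 * n + 1) = ?x"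
        using vertex_value_right[OF n(1)] right_map_inverse[of ?x] n(2) by argo
      then show ?thesis using n(1) by (intro exI[of _ "3 * n + 1"]) simp
    next
      case 5
      \<comment> \<open>The preimage has ceiling \<open>k = \<lfloor>q / (2 p)\<rfloor>\<close>, hence equals
        \<open>2 k - q / (2 p) = (4 k p - q) / (2 p)\<close>.\<close>
      define k where "k = q div (2 * p)"
      have "0 < 2 * p" using numerator.prems by simp
      then have "1 \<le> k" unfolding k_def using 5 by (simp add: less_eq_div_iff_mult_less_eq)
      have "q < 2 * p * (k + 1)"
        using dividend_less_times_div[OF \<open>0 < 2 * p\<close>, of q] by (simp add: k_def)
      also have "\<dots> \<le> 4 * k * p" using \<open>1 \<le> k\<close> by (simp add: algebra_simps)
      finally have "q < 4 * k * p" .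
      then obtain n where n: "n \<ge> 1" "vertex_value n = of_nat (4 * k * p - q) / of_nat (2 * p)"
        using denominator.IH[OF 5] \<open>0 < 2 * p\<close> by (metis zero_less_diff)
      have "\<lfloor>1 / (2 * ?x)\<rfloor> = int k"
        using floor_divide_of_nat_eq[of q "2 * p", where 'a = rat] by (simp add: k_def)
      then have "vertex_value n = 2 * of_int \<lfloor>1 / (2 * ?x)\<rfloor> - 1 / (2 * ?x)"
        using n(2) \<open>q < 4 * k * p\<close> numerator.prems denominator.prems
        by (simp add: of_nat_diff field_simps)
      then have "vertex_value (3 * n - 1) = ?x"
        using left_map_floor[OF pos] vertex_value_left[OF n(1)] by argo
      then show ?thesis using n(1) by (intro exI[of _ "3 * n - 1"]) simp
    qed
  qed
qed

lemma vertex_value_surj: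
  assumes "0 < x"
  shows "\<exists>n\<ge>1. vertex_value n = x"
proof -
  obtain a b where ab: "x = Fract a b" "0 < b" by (cases x) auto
  then have "0 < a" using assms by (simp add: zero_less_Fract_iff)
  then have "x = of_nat (nat a) / of_nat (nat b)"
    using ab by (simp add: Fract_of_int_quotient)
  then show ?thesis using vertex_value_surj_fraction[of "nat a" "nat b"] \<open>0 < a\<close> ab(2) by simp
qed

theorem theorem1:
  shows "bij_betw t (UNIV :: nat set) {q :: rat. 0 \<le> q}"
proof (rule bij_betw_imageI)
  have t0: "t 0 = 0" by (simp add: t_def)
  have t_pos: "0 < t n" if "n \<ge> 1" for n
    using vertex_value_pos[OF that] by (simp add: t_eq_vertex_value[OF that])
  show "inj t"
  proof (rule injI)
    fix m n assume eq: "t m = t n"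
    show "m = n"
    proof (cases "m = 0 \<or> n = 0")
      case True
      then show ?thesis using eq t0 t_pos[of m] t_pos[of n] by (cases m; cases n) auto
    next
      case False
      then have "m \<ge> 1" "n \<ge> 1" by auto
      moreover from this have "vertex_value m = vertex_value n"
        using eq by (simp add: t_eq_vertex_value)
      ultimately show ?thesis by (rule vertex_value_inj)
    qed
  qed
  show "range t = {q. 0 \<le> q}"
  proof (intro equalityI subsetI)
    fix q assume "q \<in> range t"
    then obtain n where "q = t n" by auto
    then show "q \<in> {q. 0 \<le> q}" using t0 t_pos[of n] by (cases n) auto
  next
    fix q :: rat assume "q \<in> {q. 0 \<le> q}"
    then consider "q = 0" | "0 < q" by fastforce
    then show "q \<in> range t"
    proof cases
      case 1
      then show ?thesis using t0 by (metis rangeI)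
    next
      case 2
      then obtain n where "n \<ge> 1" "vertex_value n = 1 / (2 * q)"
        using vertex_value_surj[of "1 / (2 * q)"] by auto
      then have "t n = q" by (simp add: t_eq_vertex_value)
      then show ?thesis by (metis rangeI)
    qed
  qed
qed

end
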